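(* Let $L$ be a complete lowly finite distributive lattice, $M$ a subset of $L$ such that $\mathrm{ji}(L) \subseteq M$, and $f: L \rightarrow G$ a valuation on $L$ with values in a $\mathbb{Z}$-module $G$. If $a \in M \setminus \mathrm{ji}(L)$, then $$\sum_{b \in [\mathsf{0},a] \cap M} \mu_M(b,a) f(b) = 0.$$
   Context: A poset is complete if it has a greatest element $\mathsf{1}$ and a lowest element $\mathsf{0}$. A poset $L$ is lowly finite if $\{b \in L \mid b \preceq a\}$ is finite for every $a \in L$. An element $a$ of a lattice $L$ is join-irreducible if, for any nonempty subset $S \subseteq L$, $a = \bigvee_{b \in S} b$ implies $a \in S$; $\mathrm{ji}(L)$ denotes the set of join-irreducible elements of $L$ (with this convention $\mathsf{0} \in \mathrm{ji}(L)$). A valuation on a lattice $L$ is a function $f$ from $L$ to a $\mathbb{Z}$-module $G$ such that $f(a \wedge b) + f(a \vee b) = f(a) + f(b)$ for all $a,b \in L$. The subset $M$ is a poset under the order induced from $L$, and $\mu_M$ denotes its Möbius function: $\mu_M(a,a)=1$ and $\mu_M(a,b) = -\sum_{c \in M,\, a \preceq c \prec b} \mu_M(a,c)$ for $a \prec b$ in $M$. $[\mathsf{0},a] = \{b \in L \mid b \preceq a\}$. *)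

theory Defs
  imports Main "HOL-Library.Lub_Glb"
begin

definition lowly_finite :: "'a::order set \<Rightarrow> bool" where
  "lowly_finite L \<longleftrightarrow> (\<forall>a\<in>L. finite {b \<in> L. b \<le> a})"

text \<open>Since only nonempty sets \<open>S\<close> are considered, the least element is join-irreducible.\<close>

definition ji :: "'a::lattice set" where
  "ji = {a. \<forall>S. S \<noteq> {} \<longrightarrow> isLub UNIV S a \<longrightarrow> a \<in> S}"

definition valuation :: "('a::lattice \<Rightarrow> 'g::ab_group_add) \<Rightarrow> bool" where
  "valuation f \<longleftrightarrow> (\<forall>a b. f (inf a b) + f (sup a b) = f a + f b)"

text \<open>
  The Moebius function of \<open>M\<close> with the induced order. It is only meaningful for arguments in
  \<open>M\<close>; the finiteness guard makes the recursion terminate, and is vacuous when \<open>M\<close> is locally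
  finite. For incomparable arguments the value is \<open>0\<close>.
\<close>

function moebius :: "'a::order set \<Rightarrow> 'a \<Rightarrow> 'a \<Rightarrow> int" where
  "moebius M a b =
    (if a = b then 1
     else if a < b \<and> finite {c \<in> M. a \<le> c \<and> c < b}
       then - (\<Sum>c \<in> {c \<in> M. a \<le> c \<and> c < b}. moebius M a c)
     else 0)"
  by pat_completeness auto
termination
proof (relation "measure (\<lambda>(M, a, b). card {c \<in> M. a \<le> c \<and> c < b})")
  fix M :: "'a set" and a b c :: 'a
  assume "a < b \<and> finite {c \<in> M. a \<le> c \<and> c < b}" and c: "c \<in> {c \<in> M. a \<le> c \<and> c < b}"
  moreover have "{d \<in> M. a \<le> d \<and> d < c} \<subset> {d \<in> M. a \<le> d \<and> d < b}"
    using c by fastforce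
  ultimately show "((M, a, c), (M, a, b)) \<in> measure (\<lambda>(M, a, b). card {c \<in> M. a \<le> c \<and> c < b})"
    by (simp add: psubset_card_mono)
qed simp

declare moebius.simps [simp del]

lemma moebius_same: "moebius M a a = 1"
  by (simp add: moebius.simps)

lemma moebius_less:
  assumes "finite {c \<in> M. a \<le> c \<and> c < b}" and "a < b"
  shows "moebius M a b = - (\<Sum>c \<in> {c \<in> M. a \<le> c \<and> c < b}. moebius M a c)"
  using assms by (subst moebius.simps) auto

end

theory Submission imports Defs begin

text \<open>
  For a point \<open>a\<close> of \<open>M\<close>, let \<open>g a\<close> be the sum in question, the Moebius transform of \<open>f\<close> along
  \<open>M\<close>. Moebius inversion (lemma \<open>moebius_inversion\<close>) says that \<open>f a\<close> is the sum of \<open>g c\<close> over all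
  \<open>c \<le> a\<close> in \<open>M\<close>. Let \<open>F a\<close> be the part of this sum that comes from the join-irreducible \<open>c\<close>.
  In a distributive lattice, a join-irreducible element lies below a join if and only if it lies
  below one of the two joinands; so \<open>F\<close> counts weighted points of a set attached to \<open>a\<close> in such a
  way that joins become unions and meets become intersections, and \<open>F\<close> is a valuation
  (lemma \<open>valuation_sum_ji\<close>).

  Now let \<open>a\<close> be in \<open>M\<close> but not join-irreducible, and suppose that \<open>g\<close> vanishes at all such
  points strictly below \<open>a\<close>. Then \<open>f\<close> and \<open>F\<close> agree at the join-irreducible elements below \<open>a\<close>,
  since their sums have the same nonzero terms there. A valuation is determined on a lower
  interval by its values at join-irreducible elements (lemma \<open>valuation_eqI_ji\<close>), so \<open>f a = F a\<close>.
  But the inversion formula at \<open>a\<close> reads \<open>f a = F a + g a\<close>, because \<open>a\<close> contributes the one term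
  outside \<open>ji\<close> that is not yet known to vanish. Hence \<open>g a = 0\<close>, and well-founded induction finishes
  the argument.
\<close>

lemma lowly_finiteD:
  assumes "lowly_finite (UNIV :: 'a::order set)"
  shows "finite {b :: 'a. P b \<and> b \<le> a}"
  using assms by (auto simp: lowly_finite_def intro: rev_finite_subset)

lemma lowly_finite_less_induct:
  fixes a :: "'a::order"
  assumes lf: "lowly_finite (UNIV :: 'a set)"
    and step: "\<And>x. (\<And>y. y < x \<Longrightarrow> P y) \<Longrightarrow> P x"
  shows "P a"
proof (induction "card {b. b \<le> a}" arbitrary: a rule: less_induct)
  case less
  have "card {b. b \<le> y} < card {b. b \<le> a}" if "y < a" for y
  proof (rule psubset_card_mono)
    show "finite {b. b \<le> a}" using lowly_finiteD[OF lf, of "\<lambda>_. True" a] by simp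
    have "a \<notin> {b. b \<le> y}" using that by auto
    with that show "{b. b \<le> y} \<subset> {b. b \<le> a}" by auto
  qed
  then show ?case
    using less step by blast
qed

text \<open>
  Join-irreducibility refers to joins of arbitrary nonempty sets. Below a fixed element only
  finitely many elements are available, so if the elements strictly below \<open>x\<close> were closed under
  binary joins, then every nonempty set of them would have an upper bound strictly below \<open>x\<close>.
\<close>

lemma not_ji_binary_sup:
  fixes x :: "'a::lattice"
  assumes lf: "lowly_finite (UNIV :: 'a set)" and "x \<notin> ji"
  obtains y z where "y < x" "z < x" "x = sup y z"
proof -
  obtain S where S: "S \<noteq> {}" "isLub UNIV S x" "x \<notin> S"
    using \<open>x \<notin> ji\<close> by (auto simp: ji_def)
  have below: "s < x" if "s \<in> S" for s
    using S that by (metis isLubD2 order_le_less)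
  have "finite S"
    by (rule finite_subset[OF _ lowly_finiteD[OF lf, of "\<lambda>_. True" x]]) (use below in \<open>auto intro: less_imp_le\<close>)
  have "\<exists>y z. y < x \<and> z < x \<and> x = sup y z"
  proof (rule ccontr)
    assume no: "\<nexists>y z. y < x \<and> z < x \<and> x = sup y z"
    have closed: "sup y z < x" if "y < x" "z < x" for y z
      using no that by (metis le_sup_iff order_le_less)
    have "\<exists>u. u < x \<and> (\<forall>s\<in>S. s \<le> u)"
      using \<open>finite S\<close> S(1) below
    proof (induction S rule: finite_ne_induct)
      case (singleton s)
      then show ?case by auto
    next
      case (insert s S)
      then obtain u where u: "u < x" "\<forall>s\<in>S. s \<le> u" by auto
      then have "sup s u < x" "\<forall>t\<in>insert s S. t \<le> sup s u"
        using insert.prems closed by (auto intro: le_supI2)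
      then show ?case by blast
    qed
    then obtain u where u: "u < x" "\<forall>s\<in>S. s \<le> u" by blast
    then have "x \<le> u"
      by (intro isLub_le_isUb[OF S(2)]) (auto simp: isUb_def setle_def)
    with u(1) show False by simp
  qed
  with that show thesis by blast
qed

text \<open>
  Distributivity splits \<open>j \<le> sup a b\<close> into \<open>j = sup (inf j a) (inf j b)\<close>, so that
  irreducibility turns into primality.
\<close>

lemma ji_le_sup_iff:
  fixes j a b :: "'a::distrib_lattice"
  assumes "j \<in> ji"
  shows "j \<le> sup a b \<longleftrightarrow> j \<le> a \<or> j \<le> b"
proof
  assume "j \<le> sup a b"
  then have "j = sup (inf j a) (inf j b)"
    by (metis inf.absorb1 inf_sup_distrib1)
  then have "isLub UNIV {inf j a, inf j b} j"
    by (auto simp: isLub_def leastP_def isUb_def setle_def setge_def) (metis le_supI)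
  then have "j \<in> {inf j a, inf j b}"
    using assms by (simp add: ji_def del: insert_iff)
  then show "j \<le> a \<or> j \<le> b"
    by (metis inf.cobounded2 insertE singletonD)
qed (auto intro: le_supI1 le_supI2)

lemma valuation_sum_ji:
  fixes g :: "'a::distrib_lattice \<Rightarrow> 'g::ab_group_add"
  assumes lf: "lowly_finite (UNIV :: 'a set)"
  shows "valuation (\<lambda>a. \<Sum>j | j \<in> ji \<and> j \<le> a. g j)"
  unfolding valuation_def
proof (intro allI)
  fix a b :: 'a
  let ?J = "\<lambda>x. {j. j \<in> ji \<and> j \<le> x}"
  have "?J (inf a b) = ?J a \<inter> ?J b" "?J (sup a b) = ?J a \<union> ?J b"
    by (auto simp: ji_le_sup_iff)
  then show "sum g (?J (inf a b)) + sum g (?J (sup a b)) = sum g (?J a) + sum g (?J b)"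
    using sum.union_inter[of "?J a" "?J b" g] lowly_finiteD[OF lf] by (simp add: add.commute)
qed

text \<open>
  An element that is not join-irreducible is a join of two strictly smaller ones, whose meet is
  smaller too; the valuation identity then expresses its value through values further down.
\<close>

lemma valuation_eqI_ji:
  fixes f F :: "'a::lattice \<Rightarrow> 'g::ab_group_add"
  assumes lf: "lowly_finite (UNIV :: 'a set)"
    and f: "valuation f" and F: "valuation F"
    and eq: "\<And>j. j \<in> ji \<Longrightarrow> j \<le> a \<Longrightarrow> f j = F j"
  shows "f a = F a"
  using eq
proof (induction a rule: lowly_finite_less_induct[OF lf])
  case (1 x)
  show ?case
  proof (cases "x \<in> ji")
    case True
    then show ?thesis by (rule 1(2)) simp
  next
    case False
    then obtain y z where yz: "y < x" "z < x" "x = sup y z"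
      by (rule not_ji_binary_sup[OF lf])
    then have "inf y z < x"
      by (meson inf.cobounded1 order_le_less_trans)
    have IH: "f w = F w" if "w < x" for w
    proof (rule 1(1)[OF that])
      fix j assume "j \<in> ji" "j \<le> w"
      then show "f j = F j"
        using that by (intro 1(2)) auto
    qed
    have "f (sup y z) = f y + f z - f (inf y z)"
      using f unfolding valuation_def by (metis add_diff_cancel_left')
    also have "\<dots> = F y + F z - F (inf y z)"
      using IH yz \<open>inf y z < x\<close> by simp
    also have "\<dots> = F (sup y z)"
      using F unfolding valuation_def by (metis add_diff_cancel_left')
    finally show ?thesis using yz by simp
  qed
qed

lemma sum_moebius:
  fixes a b :: "'a::order"
  assumes lf: "lowly_finite (UNIV :: 'a set)" and "a \<in> M" "b \<in> M" "a \<le> b"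
  shows "(\<Sum>c | c \<in> M \<and> a \<le> c \<and> c \<le> b. moebius M a c) = (if a = b then 1 else 0)"
proof (cases "a = b")
  case True
  then have "{c. c \<in> M \<and> a \<le> c \<and> c \<le> b} = {a}"
    using assms by auto
  then show ?thesis using True by (simp add: moebius_same)
next
  case False
  then have "a < b" using assms by simp
  have fin: "finite {c \<in> M. a \<le> c \<and> c < b}"
    by (rule finite_subset[OF _ lowly_finiteD[OF lf, of "\<lambda>_. True" b]]) auto
  have "{c. c \<in> M \<and> a \<le> c \<and> c \<le> b} = insert b {c \<in> M. a \<le> c \<and> c < b}"
    using assms by auto
  then show ?thesis
    using False fin \<open>a < b\<close> by (simp add: moebius_less)
qed

text \<open>
  Exchanging the two summations leaves, for each \<open>b \<le> a\<close>, the coefficient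
  \<open>\<Sum>\<^sub>c \<mu> b c\<close> over the interval from \<open>b\<close> to \<open>a\<close>, which is \<open>0\<close> unless \<open>b = a\<close>.
\<close>

lemma moebius_inversion:
  fixes M :: "'a::order set"
    and scale :: "int \<Rightarrow> 'g::ab_group_add \<Rightarrow> 'g" (infixr "*s" 75)
  assumes lf: "lowly_finite (UNIV :: 'a set)" and mod: "module scale" and "a \<in> M"
  shows "(\<Sum>c | c \<in> M \<and> c \<le> a. \<Sum>b | b \<in> M \<and> b \<le> c. moebius M b c *s f b) = f a"
proof -
  interpret module scale by (rule mod)
  let ?D = "{b. b \<in> M \<and> b \<le> a}"
  have fin: "finite ?D" by (rule lowly_finiteD[OF lf])
  have "(\<Sum>c\<in>?D. \<Sum>b | b \<in> M \<and> b \<le> c. moebius M b c *s f b)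
      = (\<Sum>c\<in>?D. \<Sum>b | b \<in> ?D \<and> b \<le> c. moebius M b c *s f b)"
    by (intro sum.cong) auto
  also have "\<dots> = (\<Sum>b\<in>?D. \<Sum>c | c \<in> ?D \<and> b \<le> c. moebius M b c *s f b)"
    using sum.swap_restrict[OF fin fin] by simp
  also have "\<dots> = (\<Sum>b\<in>?D. (\<Sum>c | c \<in> M \<and> b \<le> c \<and> c \<le> a. moebius M b c) *s f b)"
    by (simp add: scale_sum_left conj_ac)
  also have "\<dots> = (\<Sum>b\<in>?D. if b = a then f b else 0)"
    using \<open>a \<in> M\<close> by (intro sum.cong) (auto simp: sum_moebius[OF lf])
  also have "\<dots> = f a"
    using fin \<open>a \<in> M\<close> by simp
  finally show ?thesis .
qed

theorem corollary4p21:
  fixes M :: "'a::{distrib_lattice, bounded_lattice} set"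
    and scale :: "int \<Rightarrow> 'g::ab_group_add \<Rightarrow> 'g" (infixr "*s" 75)
    and f :: "'a \<Rightarrow> 'g"
    and a :: 'a
  assumes "lowly_finite (UNIV :: 'a set)"
    and "ji \<subseteq> M"
    and "module scale"
    and "valuation f"
    and "a \<in> M - ji"
  shows "(\<Sum>b \<in> {bot..a} \<inter> M. moebius M b a *s f b) = 0"
proof -
  note lf = assms(1)
  define g where "g = (\<lambda>a. \<Sum>b | b \<in> M \<and> b \<le> a. moebius M b a *s f b)"
  define F where "F = (\<lambda>a. \<Sum>j | j \<in> ji \<and> j \<le> a. g j)"
  have F: "valuation F"
    unfolding F_def by (rule valuation_sum_ji[OF lf])
  have inversion: "f c = (\<Sum>d | d \<in> M \<and> d \<le> c. g d)" if "c \<in> M" for c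
    unfolding g_def using moebius_inversion[OF lf assms(3) that] by simp
  have "g a = 0"
    using assms(5)
  proof (induction a rule: lowly_finite_less_induct[OF lf])
    case (1 a)
    have "f j = F j" if "j \<in> ji" "j \<le> a" for j
    proof -
      have "j < a" using that 1 by (metis DiffD2 order_le_less)
      have "f j = (\<Sum>d | d \<in> M \<and> d \<le> j. g d)"
        using that assms(2) by (intro inversion) auto
      also have "\<dots> = F j"
        unfolding F_def
      proof (rule sum.mono_neutral_right)
        show "\<forall>d \<in> {d. d \<in> M \<and> d \<le> j} - {d. d \<in> ji \<and> d \<le> j}. g d = 0"
        proof
          fix d assume "d \<in> {d. d \<in> M \<and> d \<le> j} - {d. d \<in> ji \<and> d \<le> j}"
          then show "g d = 0"
            using \<open>j < a\<close> by (intro 1(1)) auto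
        qed
      qed (use assms(2) lowly_finiteD[OF lf] in auto)
      finally show ?thesis .
    qed
    then have "f a = F a"
      by (rule valuation_eqI_ji[OF lf assms(4) F])
    moreover have "f a = (\<Sum>d\<in>insert a {j. j \<in> ji \<and> j \<le> a}. g d)"
    proof -
      have "f a = (\<Sum>d | d \<in> M \<and> d \<le> a. g d)"
        using 1(2) by (intro inversion) auto
      also have "\<dots> = (\<Sum>d\<in>insert a {j. j \<in> ji \<and> j \<le> a}. g d)"
      proof (rule sum.mono_neutral_right)
        show "\<forall>d \<in> {d. d \<in> M \<and> d \<le> a} - insert a {j. j \<in> ji \<and> j \<le> a}. g d = 0"
        proof
          fix d assume "d \<in> {d. d \<in> M \<and> d \<le> a} - insert a {j. j \<in> ji \<and> j \<le> a}"
          then show "g d = 0"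
            by (intro 1(1)) auto
        qed
      qed (use 1(2) assms(2) lowly_finiteD[OF lf] in auto)
      finally show ?thesis .
    qed
    moreover have "(\<Sum>d\<in>insert a {j. j \<in> ji \<and> j \<le> a}. g d) = g a + F a"
      unfolding F_def using 1(2) lowly_finiteD[OF lf] by (intro sum.insert) auto
    ultimately show "g a = 0" by simp
  qed
  moreover have "{bot..a} \<inter> M = {b. b \<in> M \<and> b \<le> a}" by auto
  ultimately show ?thesis by (simp add: g_def)
qed

end
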